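(* There is an absolute constant $C>0$ such that the following holds. Let $p\in(0,\tfrac12]$, $K\ge1$, and let $f\colon\{0,1\}^n\to\{0,1\}$ be a Boolean function with $p\,\mathrm{I}[f]<K\mu_p(f)$. Then there is a set $J\subseteq[n]$ with $|J|\le CK$ such that $\mu_p(f_{J\to1})\ge e^{-CK}$.
   Context: $\mu_p$ is the $p$-biased product measure on $\{0,1\}^n$ and $\mu_p(f)=\mathbb{E}_{\mu_p}[f]$. The total influence is $\mathrm{I}[f]=\sum_{i=1}^n\Pr_{\mathbf{x}\sim\mu_p}[f(\mathbf{x}\oplus e_i)\ne f(\mathbf{x})]$. For $J\subseteq[n]$, $f_{J\to1}$ is the restriction of $f$ obtained by setting all coordinates in $J$ to $1$, viewed as a function of the other coordinates with measure $\mu_p$. *)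

theory Defs
  imports "HOL-Probability.Probability"
begin

text \<open>
  A point of the cube \<open>{0,1}\<^sup>S\<close> over a finite index set \<open>S\<close> is a function \<open>'i \<Rightarrow> bool\<close> that is
  \<open>False\<close> outside \<open>S\<close>; these are exactly the points on which \<open>Pi_pmf S False\<close> lives.
  A Boolean function on the cube is a predicate on \<open>'i \<Rightarrow> bool\<close>; every notion below depends only
  on its values at points of the cube.
\<close>

definition biased_measure :: "'i set \<Rightarrow> real \<Rightarrow> ('i \<Rightarrow> bool) pmf" where
  "biased_measure S p = Pi_pmf S False (\<lambda>_. bernoulli_pmf p)"

definition biased_mean :: "'i set \<Rightarrow> real \<Rightarrow> (('i \<Rightarrow> bool) \<Rightarrow> bool) \<Rightarrow> real" where
  "biased_mean S p f = measure_pmf.expectation (biased_measure S p) (\<lambda>x. of_bool (f x))"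

definition flip_coord :: "'i \<Rightarrow> ('i \<Rightarrow> bool) \<Rightarrow> ('i \<Rightarrow> bool)" where
  "flip_coord i x = x(i := \<not> x i)"

definition total_influence :: "'i set \<Rightarrow> real \<Rightarrow> (('i \<Rightarrow> bool) \<Rightarrow> bool) \<Rightarrow> real" where
  "total_influence S p f =
     (\<Sum>i\<in>S. measure_pmf.prob (biased_measure S p) {x. f (flip_coord i x) \<noteq> f x})"

text \<open>For \<open>f\<close> on the cube over \<open>S\<close> and \<open>J \<subseteq> S\<close>, the restriction is a function on the cube
  over \<open>S - J\<close>.\<close>

definition restrict_to_one :: "'i set \<Rightarrow> (('i \<Rightarrow> bool) \<Rightarrow> bool) \<Rightarrow> ('i \<Rightarrow> bool) \<Rightarrow> bool" where
  "restrict_to_one J f y = f (\<lambda>i. if i \<in> J then True else y i)"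

end

theory Submission
  imports Defs
begin

text \<open>
  Let \<open>T\<close> be the noise operator with correlation \<open>1/4\<close> and \<open>\<mu>\<close> the mean of \<open>f\<close>. Small influence means that
  the Fourier weight of \<open>f\<close> sits on average on levels at most \<open>K\<close>, so by convexity
  \<open>E[f T f] \<ge> 4\<^sup>-\<^sup>K \<mu>\<close>. If on the other hand every restriction \<open>f\<close> with \<open>J\<close> set to one has mean at most
  \<open>\<delta> e\<^bsup>|J|\<^esup>\<close>, then hypercontractivity for global functions gives \<open>E[(T f)\<^sup>4] \<le> \<delta> \<mu>\<close> and
  Hoelder's inequality gives \<open>E[f T f] \<le> \<delta>\<^bsup>1/4\<^esup> \<mu>\<close>. Taking \<open>\<delta> = 4\<^bsup>-4K\<^esup>\<close> yields a contradiction;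
  for \<open>|J| > log (1/\<delta>)\<close> the bound on restrictions holds trivially.

  The hypercontractive estimate is proved by induction on the dimension in the polarised form
  \<open>E[(T f)\<^sup>2 (T g)\<^sup>2] \<le> \<Sum>\<^sub>S c\<^bsup>|S|\<^esup> W\<^sub>S(f) W\<^sub>S(g)\<close>, where \<open>W\<^sub>S\<close> is
  the generalised influence of \<open>S\<close>: with two functions, the cross terms
  of the induction step are again of the form covered by the induction hypothesis.
\<close>

section \<open>Mean, noise and influences by recursion on the dimension\<close>

definition coord_avg :: "real \<Rightarrow> nat \<Rightarrow> ((nat \<Rightarrow> bool) \<Rightarrow> real) \<Rightarrow> (nat \<Rightarrow> bool) \<Rightarrow> real" where
  "coord_avg p i f x = (1 - p) * f (x(i := False)) + p * f (x(i := True))"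

definition coord_diff :: "nat \<Rightarrow> ((nat \<Rightarrow> bool) \<Rightarrow> real) \<Rightarrow> (nat \<Rightarrow> bool) \<Rightarrow> real" where
  "coord_diff i f x = f (x(i := True)) - f (x(i := False))"

text \<open>Coordinates are integrated out from the top, so induction on \<open>n\<close> splits
  \<open>f\<close> into average and difference. The base point matches the default
  \<open>False\<close> of \<open>Pi_pmf\<close>.\<close>

primrec cube_mean :: "real \<Rightarrow> nat \<Rightarrow> ((nat \<Rightarrow> bool) \<Rightarrow> real) \<Rightarrow> real" where
  "cube_mean p 0 f = f (\<lambda>_. False)"
| "cube_mean p (Suc n) f = cube_mean p n (coord_avg p (Suc n) f)"

text \<open>
  In Fourier terms, \<open>noise\<close> multiplies level \<open>k\<close> by \<open>4\<^bsup>-k\<^esup>\<close>. The decomposition used is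
  \<open>f = coord_avg f + \<phi> \<cdot> coord_diff f\<close> with \<open>\<phi> = 1 - p\<close> or \<open>-p\<close> according to the value of
  the coordinate, so that \<open>\<phi>\<close> has mean \<open>0\<close> and variance \<open>p (1 - p)\<close>.
\<close>

primrec noise :: "real \<Rightarrow> nat \<Rightarrow> ((nat \<Rightarrow> bool) \<Rightarrow> real) \<Rightarrow> (nat \<Rightarrow> bool) \<Rightarrow> real" where
  "noise p 0 f x = f (\<lambda>_. False)"
| "noise p (Suc n) f x = noise p n (coord_avg p (Suc n) f) x
     + (if x (Suc n) then 1 - p else - p) / 4 * noise p n (coord_diff (Suc n) f) x"

text \<open>
  With \<open>\<sigma>\<^sup>2 = p (1 - p)\<close>, this is \<open>\<sigma>\<^bsup>-2|S|\<^esup> \<Sum>\<^bsub>T \<supseteq> S\<^esub> 4\<^bsup>-|T|\<^esup> f\<^sub>T\<^sup>2\<close>, where the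
  \<open>f\<^sub>T\<close> are the Fourier coefficients of \<open>f\<close>.
\<close>

primrec gen_influence ::
    "real \<Rightarrow> nat \<Rightarrow> nat set \<Rightarrow> ((nat \<Rightarrow> bool) \<Rightarrow> real) \<Rightarrow> real" where
  "gen_influence p 0 S f = (f (\<lambda>_. False))\<^sup>2"
| "gen_influence p (Suc n) S f =
     (if Suc n \<in> S then gen_influence p n S (coord_diff (Suc n) f) / 4
      else gen_influence p n S (coord_avg p (Suc n) f)
         + p * (1 - p) / 4 * gen_influence p n S (coord_diff (Suc n) f))"

text \<open>
  This is \<open>2\<^bsup>-|S|\<^esup>\<close> times the sum of the means of \<open>f\<close> over all \<open>2\<^bsup>|S|\<^esup>\<close> ways of fixing the
  coordinates in \<open>S\<close>.
\<close>

primrec subcube_sum :: "real \<Rightarrow> nat \<Rightarrow> nat set \<Rightarrow> ((nat \<Rightarrow> bool) \<Rightarrow> real) \<Rightarrow> real" where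
  "subcube_sum p 0 S f = f (\<lambda>_. False)"
| "subcube_sum p (Suc n) S f =
     (if Suc n \<in> S
      then (subcube_sum p n S (\<lambda>x. f (x(Suc n := False)))
          + subcube_sum p n S (\<lambda>x. f (x(Suc n := True)))) / 2
      else subcube_sum p n S (coord_avg p (Suc n) f))"

section \<open>Linearity, monotonicity and sums over subsets\<close>

lemma coord_avg_add:
  "coord_avg p i (\<lambda>x. f x + g x) = (\<lambda>x. coord_avg p i f x + coord_avg p i g x)"
  by (simp add: coord_avg_def fun_eq_iff algebra_simps)

lemma coord_avg_cmult: "coord_avg p i (\<lambda>x. c * f x) = (\<lambda>x. c * coord_avg p i f x)"
  by (simp add: coord_avg_def fun_eq_iff algebra_simps)

lemma coord_avg_mono:
  assumes "0 \<le> p" "p \<le> 1" "\<And>x. f x \<le> g x"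
  shows "coord_avg p i f x \<le> coord_avg p i g x"
  unfolding coord_avg_def using assms by (intro add_mono mult_left_mono) auto

lemma coord_avg_square:
  "coord_avg p i (\<lambda>x. (f x)\<^sup>2) x = (coord_avg p i f x)\<^sup>2 + p * (1 - p) * (coord_diff i f x)\<^sup>2"
  by (simp add: coord_avg_def coord_diff_def power2_eq_square algebra_simps)

lemma cube_mean_add:
  "cube_mean p n (\<lambda>x. f x + g x) = cube_mean p n f + cube_mean p n g"
  by (induction n arbitrary: f g) (simp_all add: coord_avg_add)

lemma cube_mean_cmult: "cube_mean p n (\<lambda>x. c * f x) = c * cube_mean p n f"
  by (induction n arbitrary: f) (simp_all add: coord_avg_cmult)

lemma cube_mean_mono:
  assumes "0 \<le> p" "p \<le> 1" "\<And>x. f x \<le> g x"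
  shows "cube_mean p n f \<le> cube_mean p n g"
  using assms(3) by (induction n arbitrary: f g) (simp_all add: assms(1,2) coord_avg_mono)

lemma subcube_sum_add:
  "subcube_sum p n S (\<lambda>x. f x + g x) = subcube_sum p n S f + subcube_sum p n S g"
  by (induction n arbitrary: f g) (simp_all add: coord_avg_add add_divide_distrib)

lemma subcube_sum_cmult: "subcube_sum p n S (\<lambda>x. c * f x) = c * subcube_sum p n S f"
  by (induction n arbitrary: f) (simp_all add: coord_avg_cmult algebra_simps)

lemma subcube_sum_mono:
  assumes "0 \<le> p" "p \<le> 1" "\<And>x. f x \<le> g x"
  shows "subcube_sum p n S f \<le> subcube_sum p n S g"
  using assms(3)
proof (induction n arbitrary: f g)
  case (Suc n)
  have "subcube_sum p n S (\<lambda>x. f (x(Suc n := b))) \<le> subcube_sum p n S (\<lambda>x. g (x(Suc n := b)))" for b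
    using Suc by simp
  moreover have "subcube_sum p n S (coord_avg p (Suc n) f) \<le> subcube_sum p n S (coord_avg p (Suc n) g)"
    using Suc assms coord_avg_mono by metis
  ultimately show ?case by (simp add: add_mono)
qed simp

lemma noise_upd: "n < k \<Longrightarrow> noise p n f (x(k := b)) = noise p n f x"
  by (induction n arbitrary: f) simp_all

lemma gen_influence_insert: "n < k \<Longrightarrow> gen_influence p n (insert k S) f = gen_influence p n S f"
  by (induction n arbitrary: f) simp_all

lemma gen_influence_nonneg:
  assumes "0 \<le> p" "p \<le> 1"
  shows "0 \<le> gen_influence p n S f"
  using assms by (induction n arbitrary: f) simp_all

lemma sum_Pow_atLeastAtMost_Suc:
  fixes g :: "nat set \<Rightarrow> real"
  shows "(\<Sum>S\<in>Pow {1..Suc n}. g S) = (\<Sum>S\<in>Pow {1..n}. g S + g (insert (Suc n) S))"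
proof -
  have eq: "Pow {1..Suc n} = Pow {1..n} \<union> insert (Suc n) ` Pow {1..n}"
    by (simp add: atLeastAtMostSuc_conv Pow_insert)
  have disj: "Pow {1..n} \<inter> insert (Suc n) ` Pow {1..n} = {}"
    by auto
  have inj: "inj_on (insert (Suc n)) (Pow {1..n})"
    by (rule inj_onI) (metis PowD Suc_n_not_le_n atLeastAtMost_iff insert_ident subsetD)
  show ?thesis
    unfolding eq using disj
    by (subst sum.union_disjoint)
      (simp_all only: sum.reindex[OF inj] sum.distrib comp_def finite_Pow_iff finite_imageI finite_atLeastAtMost)
qed

lemma
  assumes "S \<in> Pow {1..n}"
  shows Suc_notin_Pow: "Suc n \<notin> S"
    and card_insert_Pow: "card (insert (Suc n) S) = Suc (card S)"
proof -
  show *: "Suc n \<notin> S" using assms by auto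
  have "finite S" using assms finite_subset by auto
  with * show "card (insert (Suc n) S) = Suc (card S)" by simp
qed

section \<open>Hypercontractivity in polarised form\<close>

text \<open>The first four moments of \<phi> are 0, s, (1 - 2p)s, (1 - 3s)s with s = p(1 - p), so
  every term beyond \<open>a\<^sup>2 * b\<^sup>2\<close> carries a factor s. AM-GM removes the mixed
  terms, leaving products of one square from a, c and one from b, d, as the induction
  requires.\<close>

lemma two_point_fourth_moment:
  fixes p a b c d :: real
  assumes "0 \<le> p" "p \<le> 1"
  shows "(1 - p) * ((a + (- p) / 4 * c)\<^sup>2 * (b + (- p) / 4 * d)\<^sup>2)
       + p * ((a + (1 - p) / 4 * c)\<^sup>2 * (b + (1 - p) / 4 * d)\<^sup>2)
     \<le> a\<^sup>2 * b\<^sup>2 + p * (1 - p) / 4 * (a\<^sup>2 * d\<^sup>2 + c\<^sup>2 * b\<^sup>2) + 3 / 256 * (p * (1 - p)) * (c\<^sup>2 * d\<^sup>2)"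
    (is "?L \<le> ?R")
proof -
  define s where "s = p * (1 - p)"
  have s: "0 \<le> s" using assms by (simp add: s_def)
  define u v w where "u = a * d" and "v = c * b" and "w = c * d / 4"
  have L: "?L = a\<^sup>2 * b\<^sup>2 + s / 16 * (u\<^sup>2 + v\<^sup>2 + 4 * (u * v))
      + 2 * (1 - 2 * p) * s / 16 * (u * w + v * w) + s * (1 - 3 * s) / 16 * w\<^sup>2"
    unfolding s_def u_def v_def w_def by (simp add: power2_eq_square field_simps)
  have R: "?R = a\<^sup>2 * b\<^sup>2 + s / 4 * (u\<^sup>2 + v\<^sup>2) + 3 / 16 * s * w\<^sup>2"
    unfolding s_def u_def v_def w_def by (simp add: power2_eq_square algebra_simps)
  have cross: "2 * (1 - 2 * p) * (t * w) \<le> t\<^sup>2 + w\<^sup>2" for t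
  proof -
    have "\<bar>2 * (1 - 2 * p) * (t * w)\<bar> \<le> 2 * 1 * \<bar>t * w\<bar>"
      unfolding abs_mult using assms by (intro mult_mono) auto
    also have "\<dots> \<le> t\<^sup>2 + w\<^sup>2"
      using sum_squares_bound[of "\<bar>t\<bar>" "\<bar>w\<bar>"] by (simp add: abs_mult)
    finally show ?thesis by linarith
  qed
  \<comment> \<open>AM-GM on the mixed products gives the coefficients 1 + 2 + 1 = 4 and 1 + 1 + 1 =
    3; the factor s / 16, and the 1/4 inside w, turn them into 1/4 and 3/256.\<close>
  have "u\<^sup>2 + v\<^sup>2 + 4 * (u * v) + 2 * (1 - 2 * p) * (u * w + v * w) + (1 - 3 * s) * w\<^sup>2
      \<le> 4 * (u\<^sup>2 + v\<^sup>2) + 3 * w\<^sup>2"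
    using cross[of u] cross[of v] sum_squares_bound[of u v] mult_nonneg_nonneg[OF s zero_le_power2[of w]]
    by (simp add: algebra_simps)
  from mult_left_mono[OF this, of "s / 16"] s show ?thesis
    unfolding L R by (simp add: algebra_simps add_divide_distrib diff_divide_distrib)
qed

lemma noise_fourth_moment:
  assumes p: "0 \<le> p" "p \<le> 1"
  shows "cube_mean p n (\<lambda>x. (noise p n f x)\<^sup>2 * (noise p n g x)\<^sup>2)
    \<le> (\<Sum>S\<in>Pow {1..n}. (3 / 16 * (p * (1 - p))) ^ card S * (gen_influence p n S f * gen_influence p n S g))"
proof (induction n arbitrary: f g)
  case (Suc n)
  define s where "s = p * (1 - p)"
  have s: "0 \<le> s" using p by (simp add: s_def)
  define M where "M f g = cube_mean p n (\<lambda>x. (noise p n f x)\<^sup>2 * (noise p n g x)\<^sup>2)" for f g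
  define W where "W S f = gen_influence p n S f" for S f
  define q where "q S = (3 / 16 * s) ^ card S" for S :: "nat set"
  define f0 f1 g0 g1 where "f0 = coord_avg p (Suc n) f" and "f1 = coord_diff (Suc n) f"
    and "g0 = coord_avg p (Suc n) g" and "g1 = coord_diff (Suc n) g"
  have IH: "M h k \<le> (\<Sum>S\<in>Pow {1..n}. q S * (W S h * W S k))" for h k
    using Suc unfolding M_def W_def q_def s_def .
  have "cube_mean p (Suc n) (\<lambda>x. (noise p (Suc n) f x)\<^sup>2 * (noise p (Suc n) g x)\<^sup>2)
    \<le> cube_mean p n (\<lambda>x. (noise p n f0 x)\<^sup>2 * (noise p n g0 x)\<^sup>2
        + s / 4 * ((noise p n f0 x)\<^sup>2 * (noise p n g1 x)\<^sup>2 + (noise p n f1 x)\<^sup>2 * (noise p n g0 x)\<^sup>2)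
        + 3 / 256 * s * ((noise p n f1 x)\<^sup>2 * (noise p n g1 x)\<^sup>2))"
    unfolding cube_mean.simps
  proof (rule cube_mean_mono[OF p], goal_cases)
    case (1 x)
    show ?case
      using two_point_fourth_moment[OF p, of "noise p n f0 x" "noise p n f1 x" "noise p n g0 x" "noise p n g1 x"]
      by (simp add: coord_avg_def noise_upd f0_def f1_def g0_def g1_def s_def)
  qed
  also have "\<dots> = M f0 g0 + s / 4 * (M f0 g1 + M f1 g0) + 3 / 256 * s * M f1 g1"
    by (simp only: cube_mean_add cube_mean_cmult M_def)
  also have "\<dots> \<le> (\<Sum>S\<in>Pow {1..n}. q S * (W S f0 * W S g0))
      + s / 4 * ((\<Sum>S\<in>Pow {1..n}. q S * (W S f0 * W S g1)) + (\<Sum>S\<in>Pow {1..n}. q S * (W S f1 * W S g0)))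
      + 3 / 256 * s * (\<Sum>S\<in>Pow {1..n}. q S * (W S f1 * W S g1))"
    using s by (intro add_mono mult_left_mono IH) auto
  \<comment> \<open>The last term completes the product
    \<open>(W S f0 + s / 4 * W S f1) * (W S g0 + s / 4 * W S g1)\<close> in the summand of
    \<open>S\<close>; the 3/256 term is the summand of \<open>insert (Suc n) S\<close>.\<close>
  also have "\<dots> \<le> (\<Sum>S\<in>Pow {1..n}. q S * (W S f0 * W S g0)
      + s / 4 * (q S * (W S f0 * W S g1) + q S * (W S f1 * W S g0))
      + 3 / 256 * s * (q S * (W S f1 * W S g1)) + s / 4 * (s / 4) * (q S * (W S f1 * W S g1)))"
  proof -
    have "0 \<le> s / 4 * (s / 4) * (\<Sum>S\<in>Pow {1..n}. q S * (W S f1 * W S g1))"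
      using s p unfolding q_def W_def
      by (intro mult_nonneg_nonneg sum_nonneg gen_influence_nonneg zero_le_power) auto
    then show ?thesis by (simp only: sum.distrib sum_distrib_left[symmetric] le_add_same_cancel1)
  qed
  also have "\<dots> = (\<Sum>S\<in>Pow {1..Suc n}. (3 / 16 * s) ^ card S
      * (gen_influence p (Suc n) S f * gen_influence p (Suc n) S g))"
    unfolding sum_Pow_atLeastAtMost_Suc
  proof (rule sum.cong[OF refl])
    fix S assume S: "S \<in> Pow {1..n}"
    show "q S * (W S f0 * W S g0)
      + s / 4 * (q S * (W S f0 * W S g1) + q S * (W S f1 * W S g0))
      + 3 / 256 * s * (q S * (W S f1 * W S g1)) + s / 4 * (s / 4) * (q S * (W S f1 * W S g1))
      = (3 / 16 * s) ^ card S * (gen_influence p (Suc n) S f * gen_influence p (Suc n) S g)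
      + (3 / 16 * s) ^ card (insert (Suc n) S) *
        (gen_influence p (Suc n) (insert (Suc n) S) f * gen_influence p (Suc n) (insert (Suc n) S) g)"
      using Suc_notin_Pow[OF S] card_insert_Pow[OF S]
      by (simp add: gen_influence_insert q_def W_def s_def[symmetric] f0_def f1_def g0_def g1_def
          field_simps)
  qed
  finally show ?case unfolding s_def .
qed (simp add: power_mult_distrib)

section \<open>Influences bounded by means of restrictions\<close>

text \<open>Inside \<open>S\<close>, (x - y)^2 \<le> 2 x^2 + 2 y^2 and the weight 1/4 leave the
  plain average; outside \<open>S\<close>, the weight p(1 - p)/4 is at most the p(1 - p) of
  \<open>coord_avg_square\<close>.\<close>

lemma gen_influence_le_subcube_sum:
  assumes p: "0 \<le> p" "p \<le> 1"
  shows "gen_influence p n S f \<le> subcube_sum p n S (\<lambda>x. (f x)\<^sup>2)"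
proof (induction n arbitrary: f)
  case (Suc n)
  show ?case
  proof (cases "Suc n \<in> S")
    case True
    have "gen_influence p n S (coord_diff (Suc n) f) \<le> subcube_sum p n S (\<lambda>x. (coord_diff (Suc n) f x)\<^sup>2)"
      by (rule Suc)
    also have "\<dots> \<le> subcube_sum p n S (\<lambda>x. 2 * (f (x(Suc n := False)))\<^sup>2 + 2 * (f (x(Suc n := True)))\<^sup>2)"
    proof (rule subcube_sum_mono[OF p], goal_cases)
      case (1 x)
      show ?case
        using zero_le_power2[of "f (x(Suc n := False)) + f (x(Suc n := True))"]
        by (simp add: coord_diff_def power2_eq_square algebra_simps)
    qed
    finally show ?thesis using True by (simp add: subcube_sum_add subcube_sum_cmult)
  next
    case False
    have s: "0 \<le> p * (1 - p) / 4" using p by simp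
    have "gen_influence p (Suc n) S f \<le> subcube_sum p n S (\<lambda>x. (coord_avg p (Suc n) f x)\<^sup>2)
        + p * (1 - p) / 4 * subcube_sum p n S (\<lambda>x. (coord_diff (Suc n) f x)\<^sup>2)"
      using False by (simp del: times_divide_eq_left) (intro add_mono mult_left_mono s Suc)
    also have "\<dots> = subcube_sum p n S
        (\<lambda>x. (coord_avg p (Suc n) f x)\<^sup>2 + p * (1 - p) / 4 * (coord_diff (Suc n) f x)\<^sup>2)"
      by (simp only: subcube_sum_add subcube_sum_cmult)
    also have "\<dots> \<le> subcube_sum p n S (coord_avg p (Suc n) (\<lambda>x. (f x)\<^sup>2))"
    proof (rule subcube_sum_mono[OF p], goal_cases)
      case (1 x)
      have "0 \<le> p * (1 - p) * (coord_diff (Suc n) f x)\<^sup>2" using p by simp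
      then show ?case by (simp add: coord_avg_square)
    qed
    finally show ?thesis using False by simp
  qed
qed simp

text \<open>Staying on the full cube keeps the index set fixed: the composition with
  \<open>f\<close> does not depend on the coordinates in \<open>J\<close>, so averaging over them is
  harmless.\<close>

definition set_to_one :: "nat set \<Rightarrow> (nat \<Rightarrow> bool) \<Rightarrow> nat \<Rightarrow> bool" where
  "set_to_one J x = (\<lambda>i. i \<in> J \<or> x i)"

text \<open>This and the next lemma pass globalness down one dimension: \<open>J\<close> controls
  the average, \<open>insert (Suc n) J\<close> the section at \<open>True\<close>.\<close>

lemma cube_mean_set_to_one_avg:
  assumes "Suc n \<notin> J"
  shows "cube_mean p (Suc n) (\<lambda>x. h (set_to_one J x))
       = cube_mean p n (\<lambda>x. coord_avg p (Suc n) h (set_to_one J x))"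
proof -
  have "set_to_one J (x(Suc n := b)) = (set_to_one J x)(Suc n := b)" for x b
    using assms by (auto simp: set_to_one_def)
  then show ?thesis by (simp add: coord_avg_def[abs_def])
qed

lemma cube_mean_set_to_one_insert:
  "cube_mean p (Suc n) (\<lambda>x. h (set_to_one (insert (Suc n) J) x))
     = cube_mean p n (\<lambda>x. h ((set_to_one J x)(Suc n := True)))"
proof -
  have "set_to_one (insert (Suc n) J) (x(Suc n := b)) = (set_to_one J x)(Suc n := True)" for x b
    by (auto simp: set_to_one_def)
  then show ?thesis by (simp add: coord_avg_def[abs_def] algebra_simps)
qed

text \<open>
  Fixing a coordinate to \<open>False\<close> costs at most a factor \<open>1 / (1 - p) \<le> 2\<close> and fixing it to \<open>True\<close> at most
  \<open>e\<close>; the base comes from \<open>(2 + e) / 2 \<le> 5 / 2\<close>.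
\<close>

lemma subcube_sum_le:
  assumes p: "0 < p" "p \<le> 1 / 2"
    and nonneg: "\<And>x. 0 \<le> h x"
    and S: "S \<subseteq> {1..n}"
    and glob: "\<And>J. J \<subseteq> {1..n} \<Longrightarrow> cube_mean p n (\<lambda>x. h (set_to_one J x)) \<le> \<delta> * exp (real (card J))"
  shows "subcube_sum p n S h \<le> \<delta> * (5 / 2) ^ card S"
  using nonneg S glob
proof (induction n arbitrary: h S \<delta>)
  case 0
  from "0.prems"(3)[of "{}"] "0.prems"(2) show ?case by (simp add: set_to_one_def)
next
  case (Suc n)
  define S' where "S' = S - {Suc n}"
  have S': "S' \<in> Pow {1..n}" using Suc.prems(2) by (auto simp: S'_def le_Suc_eq)
  have p': "0 \<le> p" "p \<le> 1" using p by auto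
  have ins: "subcube_sum p n (insert (Suc n) S') = subcube_sum p n S'"
  proof -
    have "m < k \<Longrightarrow> subcube_sum p m (insert k S') f = subcube_sum p m S' f" for m k f
      by (induction m arbitrary: f) simp_all
    then show ?thesis by (simp add: fun_eq_iff)
  qed
  have avg: "subcube_sum p n S' (coord_avg p (Suc n) h) \<le> \<delta> * (5 / 2) ^ card S'"
  proof (rule Suc.IH)
    show "0 \<le> coord_avg p (Suc n) h x" for x
      using p Suc.prems(1) by (simp add: coord_avg_def)
    show "S' \<subseteq> {1..n}" using S' by simp
    fix J assume "J \<subseteq> {1..n}"
    then show "cube_mean p n (\<lambda>x. coord_avg p (Suc n) h (set_to_one J x)) \<le> \<delta> * exp (real (card J))"
      using Suc.prems(3)[of J] Suc_notin_Pow[of J n]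
      by (subst cube_mean_set_to_one_avg[symmetric]) (auto simp del: cube_mean.simps simp: atLeastAtMostSuc_conv)
  qed
  show ?case
  proof (cases "Suc n \<in> S")
    case False
    then show ?thesis using avg by (simp add: S'_def)
  next
    case True
    then have S_eq: "S = insert (Suc n) S'" by (auto simp: S'_def)
    \<comment> \<open>The extra \<open>exp 1\<close> pays for the element added to each
      \<open>J\<close>.\<close>
    have "subcube_sum p n S' (\<lambda>x. h (x(Suc n := True))) \<le> (\<delta> * exp 1) * (5 / 2) ^ card S'"
    proof (rule Suc.IH)
      show "0 \<le> h (x(Suc n := True))" for x using Suc.prems(1) .
      show "S' \<subseteq> {1..n}" using S' by simp
      fix J assume J: "J \<subseteq> {1..n}"
      then show "cube_mean p n (\<lambda>x. h ((set_to_one J x)(Suc n := True))) \<le> \<delta> * exp 1 * exp (real (card J))"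
        using Suc.prems(3)[of "insert (Suc n) J"] card_insert_Pow[of J n]
        unfolding cube_mean_set_to_one_insert by (simp add: exp_add atLeastAtMostSuc_conv mult_ac subset_insertI2)
    qed
    moreover have "subcube_sum p n S' (\<lambda>x. h (x(Suc n := False)))
        \<le> subcube_sum p n S' (\<lambda>x. 2 * coord_avg p (Suc n) h x)"
    proof (rule subcube_sum_mono[OF p'], goal_cases)
      case (1 x)
      have "1 * h (x(Suc n := False)) \<le> 2 * (1 - p) * h (x(Suc n := False))"
        using p Suc.prems(1) by (intro mult_right_mono) auto
      moreover have "0 \<le> p * h (x(Suc n := True))" using p Suc.prems(1) by simp
      ultimately show ?case by (simp add: coord_avg_def algebra_simps)
    qed
    moreover have "0 \<le> \<delta>"
    proof -
      have "0 = cube_mean p (Suc n) (\<lambda>x. 0 * 0)" by (simp only: cube_mean_cmult)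
      also have "\<dots> \<le> cube_mean p (Suc n) (\<lambda>x. h (set_to_one {} x))"
        using Suc.prems(1) by (intro cube_mean_mono p') simp
      also have "\<dots> \<le> \<delta>" using Suc.prems(3)[of "{}"] by simp
      finally show ?thesis .
    qed
    then have "(\<delta> * exp 1) * (5 / 2) ^ card S' \<le> (\<delta> * 3) * (5 / 2) ^ card S'"
      using exp_le by (intro mult_right_mono mult_left_mono) auto
    ultimately have "subcube_sum p (Suc n) S h \<le> (2 * (\<delta> * (5 / 2) ^ card S') + \<delta> * 3 * (5 / 2) ^ card S') / 2"
      using avg by (simp add: S_eq ins subcube_sum_cmult)
    also have "\<dots> = \<delta> * (5 / 2) ^ card S"
      using card_insert_Pow[OF S'] by (simp add: S_eq)
    finally show ?thesis .
  qed
qed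

section \<open>Fourth moment bound for global functions\<close>

text \<open>In Fourier terms the left side is the sum over T of ((1 + c)/4)^|T| f_T^2, so for c
  \<le> 3 it is at most Parseval's sum.\<close>

lemma sum_gen_influence_le:
  assumes p: "0 \<le> p" "p \<le> 1" and c: "0 \<le> c" "c \<le> 3"
  shows "(\<Sum>S\<in>Pow {1..n}. (c * (p * (1 - p))) ^ card S * gen_influence p n S f) \<le> cube_mean p n (\<lambda>x. (f x)\<^sup>2)"
proof (induction n arbitrary: f)
  case (Suc n)
  define s where "s = p * (1 - p)"
  have s: "0 \<le> s" using p by (simp add: s_def)
  define R where "R f = (\<Sum>S\<in>Pow {1..n}. (c * s) ^ card S * gen_influence p n S f)" for f
  define a d where "a = coord_avg p (Suc n) f" and "d = coord_diff (Suc n) f"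
  have R0: "0 \<le> R d"
    unfolding R_def using s c p by (intro sum_nonneg mult_nonneg_nonneg gen_influence_nonneg) auto
  have "(\<Sum>S\<in>Pow {1..Suc n}. (c * s) ^ card S * gen_influence p (Suc n) S f)
     = (\<Sum>S\<in>Pow {1..n}. (c * s) ^ card S * gen_influence p n S a
        + (s / 4 + c * s / 4) * ((c * s) ^ card S * gen_influence p n S d))"
    unfolding sum_Pow_atLeastAtMost_Suc
  proof (rule sum.cong[OF refl])
    fix S assume S: "S \<in> Pow {1..n}"
    show "(c * s) ^ card S * gen_influence p (Suc n) S f
        + (c * s) ^ card (insert (Suc n) S) * gen_influence p (Suc n) (insert (Suc n) S) f
      = (c * s) ^ card S * gen_influence p n S a
        + (s / 4 + c * s / 4) * ((c * s) ^ card S * gen_influence p n S d)"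
    proof -
      have "gen_influence p (Suc n) S f = gen_influence p n S a + s / 4 * gen_influence p n S d"
        using Suc_notin_Pow[OF S] by (simp add: a_def d_def s_def)
      moreover have "gen_influence p (Suc n) (insert (Suc n) S) f = gen_influence p n S d / 4"
        by (simp add: gen_influence_insert d_def)
      ultimately show ?thesis
        by (simp add: card_insert_Pow[OF S] algebra_simps)
    qed
  qed
  also have "\<dots> = R a + (s / 4 + c * s / 4) * R d"
    by (simp only: sum.distrib sum_distrib_left R_def)
  also have "\<dots> \<le> R a + s * R d"
  proof -
    have "c * s \<le> 3 * s" using s c by (intro mult_right_mono)
    then show ?thesis using R0 by (intro add_left_mono mult_right_mono) auto
  qed
  also have "\<dots> \<le> cube_mean p n (\<lambda>x. (a x)\<^sup>2) + s * cube_mean p n (\<lambda>x. (d x)\<^sup>2)"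
    unfolding R_def using Suc s by (intro add_mono mult_left_mono) (auto simp: s_def)
  also have "\<dots> = cube_mean p n (\<lambda>x. (a x)\<^sup>2 + s * (d x)\<^sup>2)"
    by (simp only: cube_mean_add cube_mean_cmult)
  also have "\<dots> = cube_mean p (Suc n) (\<lambda>x. (f x)\<^sup>2)"
    by (simp add: coord_avg_square[abs_def] a_def d_def s_def)
  finally show ?case unfolding s_def .
qed simp

text \<open>One of the two influence factors is replaced by \<delta> (5/2)^|S|; as 3/16 * 5/2 =
  15/32 \<le> 3, the other still sums to at most the mean of f^2 = f.\<close>

lemma noise_fourth_moment_global:
  assumes p: "0 < p" "p \<le> 1 / 2"
    and bool: "\<And>x. (f x)\<^sup>2 = f x"
    and glob: "\<And>J. J \<subseteq> {1..n} \<Longrightarrow> cube_mean p n (\<lambda>x. f (set_to_one J x)) \<le> \<delta> * exp (real (card J))"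
  shows "cube_mean p n (\<lambda>x. (noise p n f x) ^ 4) \<le> \<delta> * cube_mean p n f"
proof -
  have p': "0 \<le> p" "p \<le> 1" using p by auto
  have f0: "0 \<le> f x" for x using bool[of x] zero_le_power2[of "f x"] by simp
  define s where "s = p * (1 - p)"
  have s: "0 \<le> s" using p by (simp add: s_def)
  have "0 \<le> cube_mean p n (\<lambda>x. f (set_to_one {} x))"
    using cube_mean_mono[OF p', of "\<lambda>x. 0 * 0" "\<lambda>x. f (set_to_one {} x)" n] f0
    unfolding cube_mean_cmult by simp
  with glob[of "{}"] have \<delta>: "0 \<le> \<delta>" by simp
  have gi: "gen_influence p n S f \<le> \<delta> * (5 / 2) ^ card S" if "S \<subseteq> {1..n}" for S
    using gen_influence_le_subcube_sum[OF p', of n S f] subcube_sum_le[OF p f0 that glob]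
    by (simp add: bool)
  have "cube_mean p n (\<lambda>x. (noise p n f x) ^ 4)
      = cube_mean p n (\<lambda>x. (noise p n f x)\<^sup>2 * (noise p n f x)\<^sup>2)"
    by (simp flip: power_add)
  also have "\<dots> \<le> (\<Sum>S\<in>Pow {1..n}. (3 / 16 * s) ^ card S * (gen_influence p n S f * gen_influence p n S f))"
    unfolding s_def by (rule noise_fourth_moment[OF p'])
  also have "\<dots> \<le> (\<Sum>S\<in>Pow {1..n}. (3 / 16 * s) ^ card S * (\<delta> * (5 / 2) ^ card S * gen_influence p n S f))"
    using s by (intro sum_mono mult_left_mono mult_right_mono gi gen_influence_nonneg p') auto
  also have "\<dots> = \<delta> * (\<Sum>S\<in>Pow {1..n}. (15 / 32 * s) ^ card S * gen_influence p n S f)"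
    unfolding sum_distrib_left
  proof (rule sum.cong[OF refl])
    fix S :: "nat set"
    have "(15 / 32 * s) ^ card S = (3 / 16 * s) ^ card S * (5 / 2) ^ card S"
      by (simp flip: power_mult_distrib)
    then show "(3 / 16 * s) ^ card S * (\<delta> * (5 / 2) ^ card S * gen_influence p n S f)
        = \<delta> * ((15 / 32 * s) ^ card S * gen_influence p n S f)"
      by simp
  qed
  also have "\<dots> \<le> \<delta> * cube_mean p n (\<lambda>x. (f x)\<^sup>2)"
    unfolding s_def by (intro mult_left_mono sum_gen_influence_le p' \<delta>) auto
  finally show ?thesis by (simp add: bool)
qed

section \<open>Noise stability from above\<close>

lemma noise_stability_upper:
  assumes p: "0 < p" "p \<le> 1 / 2" and t: "0 < t"
    and bool: "\<And>x. f x = 0 \<or> f x = 1"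
    and glob: "\<And>J. J \<subseteq> {1..n} \<Longrightarrow> cube_mean p n (\<lambda>x. f (set_to_one J x)) \<le> t ^ 4 * exp (real (card J))"
  shows "cube_mean p n (\<lambda>x. f x * noise p n f x) \<le> t * cube_mean p n f"
proof -
  have p': "0 \<le> p" "p \<le> 1" using p by auto
  have bool2: "(f x)\<^sup>2 = f x" for x using bool[of x] by auto
  have "cube_mean p n (\<lambda>x. f x * noise p n f x)
      \<le> cube_mean p n (\<lambda>x. 3 / 4 * t * f x + 1 / (4 * t ^ 3) * (noise p n f x) ^ 4)"
  proof (rule cube_mean_mono[OF p'], goal_cases)
    case (1 x)
    define g where "g = noise p n f x"
    define y where "y = g / t"
    have g: "g = t * y" using t by (simp add: y_def)
    have "0 \<le> (y - 1)\<^sup>2 * ((y + 1)\<^sup>2 + 2)" by simp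
    also have "\<dots> = y ^ 4 - 4 * y + 3" by algebra
    \<comment> \<open>Hoelder's inequality with exponents 4/3 and 4, via AM-GM at scale \<open>t\<close>\<close>
    finally have "t * y \<le> t * (3 / 4 + y ^ 4 / 4)" using t by (intro mult_left_mono) auto
    also have "\<dots> = 3 / 4 * t + 1 / (4 * t ^ 3) * g ^ 4"
      unfolding g using t by (simp add: field_simps power4_eq_xxxx power3_eq_cube)
    finally have "g \<le> 3 / 4 * t + 1 / (4 * t ^ 3) * g ^ 4" by (simp add: g)
    \<comment> \<open>This settles the points where \<open>f x = 0\<close>.\<close>
    moreover have "0 \<le> 1 / (4 * t ^ 3) * g ^ 4" using t by simp
    ultimately show ?case using bool[of x] by (auto simp: g_def)
  qed
  also have "\<dots> = 3 / 4 * t * cube_mean p n f + 1 / (4 * t ^ 3) * cube_mean p n (\<lambda>x. (noise p n f x) ^ 4)"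
    by (simp only: cube_mean_add cube_mean_cmult)
  also have "\<dots> \<le> 3 / 4 * t * cube_mean p n f + 1 / (4 * t ^ 3) * (t ^ 4 * cube_mean p n f)"
    using t by (intro add_left_mono mult_left_mono noise_fourth_moment_global[OF p bool2 glob]) auto
  also have "\<dots> = t * cube_mean p n f"
    using t by (simp add: field_simps power4_eq_xxxx power3_eq_cube)
  finally show ?thesis .
qed

section \<open>Noise stability from below\<close>

lemma coord_diff_avg_commute:
  "i \<noteq> j \<Longrightarrow> coord_diff i (coord_avg p j f) = coord_avg p j (coord_diff i f)"
  by (simp add: fun_eq_iff coord_diff_def coord_avg_def fun_upd_twist algebra_simps)

lemma coord_diff_diff_commute: "i \<noteq> j \<Longrightarrow> coord_diff i (coord_diff j f) = coord_diff j (coord_diff i f)"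
  by (simp add: fun_eq_iff coord_diff_def fun_upd_twist algebra_simps)

text \<open>In Fourier terms, p(1 - p) times this is the sum of |T| f_T^2, the level weighted by the
  Fourier mass.\<close>

definition sq_influence :: "real \<Rightarrow> nat \<Rightarrow> ((nat \<Rightarrow> bool) \<Rightarrow> real) \<Rightarrow> real" where
  "sq_influence p n f = (\<Sum>i\<in>{1..n}. cube_mean p n (\<lambda>x. (coord_diff i f x)\<^sup>2))"

lemma sq_influence_Suc:
  "sq_influence p (Suc n) f = sq_influence p n (coord_avg p (Suc n) f)
     + p * (1 - p) * sq_influence p n (coord_diff (Suc n) f)
     + cube_mean p n (\<lambda>x. (coord_diff (Suc n) f x)\<^sup>2)"
proof -
  have "cube_mean p (Suc n) (\<lambda>x. (coord_diff i f x)\<^sup>2)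
      = cube_mean p n (\<lambda>x. (coord_diff i (coord_avg p (Suc n) f) x)\<^sup>2)
        + p * (1 - p) * cube_mean p n (\<lambda>x. (coord_diff i (coord_diff (Suc n) f) x)\<^sup>2)"
    if "i \<in> {1..n}" for i
  proof -
    have "i \<noteq> Suc n" using that by auto
    then show ?thesis
      by (simp add: coord_avg_square[abs_def] cube_mean_add cube_mean_cmult
          coord_diff_avg_commute coord_diff_diff_commute[of i])
  qed
  moreover have "coord_avg p (Suc n) (\<lambda>x. (coord_diff (Suc n) f x)\<^sup>2) = (\<lambda>x. (coord_diff (Suc n) f x)\<^sup>2)"
    by (simp add: fun_eq_iff coord_avg_def coord_diff_def algebra_simps)
  ultimately show ?thesis
    by (simp add: sq_influence_def sum.distrib sum_distrib_left)
qed

text \<open>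
  Integrated form of the tangent inequality
  \<open>4\<^bsup>-k\<^esup> \<ge> 4\<^bsup>-K\<^esup> (1 + (K - k) log 4)\<close> at level \<open>k\<close>. The real parameter \<open>K\<close> varies in the induction:
  it drops by one on the part of \<open>f\<close> that depends on the new coordinate.
\<close>

lemma noise_stability_lower:
  assumes p: "0 \<le> p" "p \<le> 1"
  shows "exp (- (K * ln 4)) * ((1 + K * ln 4) * cube_mean p n (\<lambda>x. (f x)\<^sup>2)
            - ln 4 * (p * (1 - p) * sq_influence p n f))
         \<le> cube_mean p n (\<lambda>x. f x * noise p n f x)"
proof (induction n arbitrary: f K)
  case 0
  \<comment> \<open>This is \<open>1 + x \<le> exp x\<close>, which also covers the negative
    \<open>K\<close> that the induction can reach.\<close>
  have "exp (- (K * ln 4)) * (1 + K * ln 4) \<le> exp (- (K * ln 4)) * exp (K * ln (4::real))"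
    by (intro mult_left_mono) auto
  also have "\<dots> = 1" by (simp flip: exp_add)
  finally have "exp (- (K * ln 4)) * (1 + K * ln 4) * (f (\<lambda>_. False))\<^sup>2 \<le> 1 * (f (\<lambda>_. False))\<^sup>2"
    by (intro mult_right_mono) auto
  then show ?case by (simp add: sq_influence_def power2_eq_square)
next
  case (Suc n)
  define s where "s = p * (1 - p)"
  have s: "0 \<le> s" using p by (simp add: s_def)
  define L where "L = ln (4::real)"
  define a d where "a = coord_avg p (Suc n) f" and "d = coord_diff (Suc n) f"
  define B where "B f = cube_mean p n (\<lambda>x. (f x)\<^sup>2)" for f
  define N where "N f = cube_mean p n (\<lambda>x. f x * noise p n f x)" for f
  have exp_shift: "exp (- ((K - 1) * L)) = 4 * exp (- (K * L))"
    by (simp add: L_def algebra_simps exp_diff exp_minus divide_inverse)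
  have sq: "cube_mean p (Suc n) (\<lambda>x. (f x)\<^sup>2) = B a + s * B d"
    by (simp add: coord_avg_square[abs_def] a_def d_def s_def B_def cube_mean_add cube_mean_cmult)
  have N: "cube_mean p (Suc n) (\<lambda>x. f x * noise p (Suc n) f x) = N a + s / 4 * N d"
  proof -
    have two_point: "(1 - p) * (u * (A + - p / 4 * D)) + p * (v * (A + (1 - p) / 4 * D))
        = ((1 - p) * u + p * v) * A + s / 4 * ((v - u) * D)" for u v A D
      unfolding s_def by (simp add: field_simps)
    have "coord_avg p (Suc n) (\<lambda>x. f x * noise p (Suc n) f x) x
       = a x * noise p n a x + s / 4 * (d x * noise p n d x)" for x
      using two_point[of "f (x(Suc n := False))" "noise p n a x" "noise p n d x" "f (x(Suc n := True))"]
      by (simp add: coord_avg_def[of _ _ "\<lambda>x. f x * _ x"] noise_upd flip: a_def d_def)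
        (simp add: a_def d_def coord_avg_def coord_diff_def)
    then have "coord_avg p (Suc n) (\<lambda>x. f x * noise p (Suc n) f x)
       = (\<lambda>x. a x * noise p n a x + s / 4 * (d x * noise p n d x))" ..
    then show ?thesis by (simp only: cube_mean.simps cube_mean_add cube_mean_cmult N_def)
  qed
  \<comment> \<open>The influence \<open>B d\<close> of the new coordinate turns
    \<open>1 + K * L\<close> into \<open>1 + (K - 1) * L\<close>, and \<open>exp_shift\<close>
    absorbs the 1/4 from the noise.\<close>
  have "exp (- (K * L)) * ((1 + K * L) * (B a + s * B d)
        - L * (s * (sq_influence p n a + s * sq_influence p n d + B d)))
     = exp (- (K * L)) * ((1 + K * L) * B a - L * (s * sq_influence p n a))
       + s / 4 * (exp (- ((K - 1) * L)) * ((1 + (K - 1) * L) * B d - L * (s * sq_influence p n d)))"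
    unfolding exp_shift by (simp add: algebra_simps)
  also have "\<dots> \<le> N a + s / 4 * N d"
    using s Suc[of K a] Suc[of "K - 1" d]
    by (intro add_mono mult_left_mono) (simp_all add: B_def N_def L_def s_def)
  finally show ?case
    unfolding sq N sq_influence_Suc L_def a_def d_def s_def B_def .
qed

section \<open>Translation to the product measure\<close>

lemma expectation_biased_measure:
  fixes f :: "(nat \<Rightarrow> bool) \<Rightarrow> real"
  assumes p: "0 \<le> p" "p \<le> 1"
  shows "measure_pmf.expectation (biased_measure {1..n} p) f = cube_mean p n f"
proof (induction n arbitrary: f)
  case 0
  then show ?case by (simp add: biased_measure_def)
next
  case (Suc n)
  have fin: "finite (set_pmf (biased_measure {1..n} p))"
    unfolding biased_measure_def by (rule finite_subset[OF set_Pi_pmf_subset']) (auto intro!: finite_PiE_dflt)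
  have eq: "biased_measure {1..Suc n} p =
      bernoulli_pmf p \<bind> (\<lambda>b. map_pmf (\<lambda>x. x(Suc n := b)) (biased_measure {1..n} p))"
    by (simp add: biased_measure_def atLeastAtMostSuc_conv Pi_pmf_insert' map_pmf_def)
  have "measure_pmf.expectation (biased_measure {1..Suc n} p) f
     = (1 - p) * measure_pmf.expectation (biased_measure {1..n} p) (\<lambda>x. f (x(Suc n := False)))
     + p * measure_pmf.expectation (biased_measure {1..n} p) (\<lambda>x. f (x(Suc n := True)))"
    unfolding eq using p fin by (subst pmf_expectation_bind[of UNIV]) (auto simp: UNIV_bool)
  also have "\<dots> = cube_mean p (Suc n) f"
    unfolding Suc by (simp add: coord_avg_def[abs_def] cube_mean_add cube_mean_cmult)
  finally show ?case .
qed

lemma biased_mean_cube_mean: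
  assumes "0 \<le> p" "p \<le> 1"
  shows "biased_mean {1..n} p f = cube_mean p n (\<lambda>x. of_bool (f x))"
  using expectation_biased_measure[OF assms] by (simp add: biased_mean_def)

text \<open>The measure on the smaller cube is the image of the full one under resetting
  \<open>J\<close> to \<open>False\<close>, and the restriction overwrites \<open>J\<close>
  anyway.\<close>

lemma biased_mean_restrict_to_one:
  assumes "0 \<le> p" "p \<le> 1" and J: "J \<subseteq> {1..n}"
  shows "biased_mean ({1..n} - J) p (restrict_to_one J f)
       = cube_mean p n (\<lambda>x. of_bool (f (set_to_one J x)))"
proof -
  have "biased_measure ({1..n} - J) p
      = map_pmf (\<lambda>x i. if i \<in> {1..n} - J then x i else False) (biased_measure {1..n} p)"
    unfolding biased_measure_def by (rule Pi_pmf_subset) auto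
  then have "biased_mean ({1..n} - J) p (restrict_to_one J f)
      = measure_pmf.expectation (biased_measure {1..n} p)
          (\<lambda>x. of_bool (restrict_to_one J f (\<lambda>i. if i \<in> {1..n} - J then x i else False)))"
    by (simp add: biased_mean_def)
  also have "\<dots> = measure_pmf.expectation (biased_measure {1..n} p) (\<lambda>x. of_bool (f (set_to_one J x)))"
  proof (intro integral_cong_AE AE_pmfI)
    \<comment> \<open>Off the support the two points may differ outside {1..n}.\<close>
    fix x assume "x \<in> set_pmf (biased_measure {1..n} p)"
    then have "\<not> x i" if "i \<notin> {1..n}" for i
      using that set_Pi_pmf_subset[of "{1..n}" False "\<lambda>_. bernoulli_pmf p"]
      unfolding biased_measure_def by auto
    then have "(\<lambda>i. if i \<in> J then True else if i \<in> {1..n} - J then x i else False) = set_to_one J x"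
      by (auto simp: set_to_one_def fun_eq_iff)
    then show "of_bool (restrict_to_one J f (\<lambda>i. if i \<in> {1..n} - J then x i else False))
        = of_bool (f (set_to_one J x))"
      unfolding restrict_to_one_def by (rule arg_cong)
  qed auto
  finally show ?thesis unfolding expectation_biased_measure[OF assms(1,2)] .
qed

lemma total_influence_sq_influence:
  assumes "0 \<le> p" "p \<le> 1"
  shows "total_influence {1..n} p f = sq_influence p n (\<lambda>x. of_bool (f x))"
  unfolding total_influence_def sq_influence_def
proof (rule sum.cong[OF refl])
  fix i
  have "(coord_diff i (\<lambda>x. of_bool (f x)) x)\<^sup>2 = indicator {x. f (flip_coord i x) \<noteq> f x} x" for x
  proof (cases "x i")
    case True
    then have "x(i := True) = x" by (simp add: fun_upd_idem)
    with True show ?thesis by (simp add: coord_diff_def flip_coord_def)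
  next
    case False
    then have "x(i := False) = x" by (simp add: fun_upd_idem)
    with False show ?thesis by (simp add: coord_diff_def flip_coord_def)
  qed
  then show "measure_pmf.prob (biased_measure {1..n} p) {x. f (flip_coord i x) \<noteq> f x}
      = cube_mean p n (\<lambda>x. (coord_diff i (\<lambda>x. of_bool (f x)) x)\<^sup>2)"
    by (simp flip: expectation_biased_measure[OF assms])
qed

section \<open>Choice of constants and contradiction\<close>

theorem theorem1p5:
  "\<exists>C::real. C > 0 \<and>
     (\<forall>(n::nat) (p::real) (K::real) (f :: (nat \<Rightarrow> bool) \<Rightarrow> bool).
        0 < p \<longrightarrow> p \<le> 1 / 2 \<longrightarrow> K \<ge> 1 \<longrightarrow>
        p * total_influence {1..n} p f < K * biased_mean {1..n} p f \<longrightarrow>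
        (\<exists>J. J \<subseteq> {1..n} \<and> real (card J) \<le> C * K \<and>
             biased_mean ({1..n} - J) p (restrict_to_one J f) \<ge> exp (- (C * K))))"
\<comment> \<open>With \<delta> = exp(-4 K ln 4), the fourth root of \<delta> is exactly the factor
  4^(-K) of the lower bound.\<close>
proof (rule exI[of _ "4 * ln 4"], intro conjI allI impI)
  show "0 < 4 * ln (4::real)" by simp
  fix n :: nat and p K :: real and f :: "(nat \<Rightarrow> bool) \<Rightarrow> bool"
  assume p: "0 < p" "p \<le> 1 / 2" and K: "K \<ge> 1"
    and infl: "p * total_influence {1..n} p f < K * biased_mean {1..n} p f"
  have p': "0 \<le> p" "p \<le> 1" using p by auto
  define g :: "(nat \<Rightarrow> bool) \<Rightarrow> real" where "g = (\<lambda>x. of_bool (f x))"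
  define L where "L = ln (4::real)"
  have L: "0 < L" by (simp add: L_def)
  define \<mu> where "\<mu> = cube_mean p n g"
  define I where "I = sq_influence p n g"
  have infl': "p * I < K * \<mu>"
    using infl unfolding total_influence_sq_influence[OF p'] biased_mean_cube_mean[OF p'] I_def \<mu>_def g_def .
  show "\<exists>J. J \<subseteq> {1..n} \<and> real (card J) \<le> 4 * ln 4 * K \<and>
      biased_mean ({1..n} - J) p (restrict_to_one J f) \<ge> exp (- (4 * ln 4 * K))"
  proof (rule ccontr)
    assume neg: "\<not> ?thesis"
    have "cube_mean p n (\<lambda>x. g (set_to_one J x)) \<le> exp (- (K * L)) ^ 4 * exp (real (card J))"
      if J: "J \<subseteq> {1..n}" for J
    proof -
      have pow: "exp (- (K * L)) ^ 4 = exp (- (4 * L * K))"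
        by (simp flip: exp_of_nat_mult)
      show ?thesis
      proof (cases "real (card J) \<le> 4 * L * K")
        case True
        then have "cube_mean p n (\<lambda>x. g (set_to_one J x)) \<le> exp (- (4 * L * K))"
          using neg J unfolding biased_mean_restrict_to_one[OF p' J] g_def L_def
          using biased_mean_restrict_to_one[OF p' J] by force
        also have "\<dots> \<le> exp (- (4 * L * K)) * exp (real (card J))" by simp
        finally show ?thesis unfolding pow .
      next
        case False
        have "cube_mean p n (\<lambda>x. g (set_to_one J x)) \<le> 1"
          using expectation_biased_measure[OF p', of n "\<lambda>x. 1"] cube_mean_mono[OF p', of _ "\<lambda>x. 1" n]
          by (simp add: g_def)
        also have "1 \<le> exp (- (4 * L * K)) * exp (real (card J))"
          using False by (simp flip: exp_add)
        finally show ?thesis unfolding pow .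
      qed
    qed
    then have "cube_mean p n (\<lambda>x. g x * noise p n g x) \<le> exp (- (K * L)) * \<mu>"
      unfolding \<mu>_def by (intro noise_stability_upper p) (auto simp: g_def)
    moreover have "exp (- (K * L)) * ((1 + K * L) * \<mu> - L * (p * (1 - p) * I))
        \<le> cube_mean p n (\<lambda>x. g x * noise p n g x)"
    proof -
      have "(g x)\<^sup>2 = g x" for x by (simp add: g_def)
      then show ?thesis using noise_stability_lower[OF p', of K n g] by (simp add: L_def \<mu>_def I_def)
    qed
    \<comment> \<open>The strict influence hypothesis makes the lower bound exceed the upper
      bound.\<close>
    moreover have "\<mu> < (1 + K * L) * \<mu> - L * (p * (1 - p) * I)"
    proof -
      have "0 \<le> I"
        unfolding I_def g_def total_influence_sq_influence[OF p', symmetric] total_influence_def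
        by (intro sum_nonneg) simp
      then have "p * (1 - p) * I \<le> p * I" using p by (simp add: mult_right_mono)
      with infl' have "L * (p * (1 - p) * I) < L * (K * \<mu>)" using L by simp
      then show ?thesis by (simp add: algebra_simps)
    qed
    ultimately show False
      by (smt (verit) exp_gt_zero mult_less_cancel_left_pos)
  qed
qed

end
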